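(* Let $n\ge 2$ and let $s,y\in\mathbb{R}^n$ satisfy $s^\top y>0$. For $\theta>0$ put $$\bar\lambda^{\pm}(\theta)=\frac12\left(1+\theta\frac{\|y\|^2}{s^\top y}\right)\frac{\|s\|^2}{s^\top y}\ \pm\ \frac12\sqrt{\left(1+\theta\frac{\|y\|^2}{s^\top y}\right)^2\frac{\|s\|^4}{(s^\top y)^2}-4\theta\frac{\|s\|^2}{s^\top y}},$$ and let $\mathrm{HM}(\theta),\mathrm{GM}(\theta),\mathrm{AM}(\theta),\mathrm{QM}(\theta)$ be the harmonic, geometric, arithmetic and quadratic means of the two positive numbers $\bar\lambda^-(\theta),\bar\lambda^+(\theta)$. Then $$\theta^*:=\frac{s^\top y}{\|y\|^2}$$ is the minimizer over $\theta>0$ of each of the six functions $$\frac{\mathrm{AM}(\theta)}{\mathrm{GM}(\theta)},\quad \frac{\mathrm{GM}(\theta)}{\mathrm{HM}(\theta)},\quad \frac{\mathrm{AM}(\theta)}{\mathrm{HM}(\theta)},\quad \frac{\mathrm{QM}(\theta)}{\mathrm{AM}(\theta)},\quad \frac{\mathrm{QM}(\theta)}{\mathrm{GM}(\theta)},\quad \frac{\mathrm{QM}(\theta)}{\mathrm{HM}(\theta)}.$$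
   Context: $\|\cdot\|$ is the Euclidean norm. For positive numbers $a_1,a_2$: $\mathrm{HM}=2/(1/a_1+1/a_2)$, $\mathrm{GM}=\sqrt{a_1a_2}$, $\mathrm{AM}=(a_1+a_2)/2$, $\mathrm{QM}=\sqrt{(a_1^2+a_2^2)/2}$. Here $s=x_{k+1}-x_k$ and $y=\nabla f(x_{k+1})-\nabla f(x_k)$; the Wolfe line search guarantees $s^\top y>0$. The numbers $\bar\lambda^\pm(\theta)$ are the two remaining eigenvalues (the other $n-2$ being $\theta$) of the scaled memoryless BFGS matrix $\theta I-\theta\frac{sy^\top+ys^\top}{s^\top y}+\left(1+\theta\frac{y^\top y}{s^\top y}\right)\frac{ss^\top}{s^\top y}$. *)

theory Defs
  imports "HOL-Analysis.Analysis"
begin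

definition HM :: "real \<Rightarrow> real \<Rightarrow> real" where
  "HM a b = 2 / (1 / a + 1 / b)"

definition GM :: "real \<Rightarrow> real \<Rightarrow> real" where
  "GM a b = sqrt (a * b)"

definition AM :: "real \<Rightarrow> real \<Rightarrow> real" where
  "AM a b = (a + b) / 2"

definition QM :: "real \<Rightarrow> real \<Rightarrow> real" where
  "QM a b = sqrt ((a\<^sup>2 + b\<^sup>2) / 2)"

(* lambda_minus and lambda_plus are the two eigenvalues, besides the (n-2)-fold eigenvalue
   theta, of the scaled memoryless BFGS matrix
     theta I - theta (s y^T + y s^T)/(s^T y) + (1 + theta y^T y/(s^T y)) s s^T/(s^T y);
   bfgs_disc is the radicand in their closed form. *)
definition bfgs_disc :: "real ^ 'n \<Rightarrow> real ^ 'n \<Rightarrow> real \<Rightarrow> real" where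
  "bfgs_disc s y \<theta> =
     (1 + \<theta> * ((norm y)\<^sup>2 / (s \<bullet> y)))\<^sup>2 * (norm s ^ 4 / (s \<bullet> y)\<^sup>2)
       - 4 * \<theta> * ((norm s)\<^sup>2 / (s \<bullet> y))"

definition lambda_minus :: "real ^ 'n \<Rightarrow> real ^ 'n \<Rightarrow> real \<Rightarrow> real" where
  "lambda_minus s y \<theta> =
     1 / 2 * (1 + \<theta> * ((norm y)\<^sup>2 / (s \<bullet> y))) * ((norm s)\<^sup>2 / (s \<bullet> y))
       - 1 / 2 * sqrt (bfgs_disc s y \<theta>)"

definition lambda_plus :: "real ^ 'n \<Rightarrow> real ^ 'n \<Rightarrow> real \<Rightarrow> real" where
  "lambda_plus s y \<theta> =
     1 / 2 * (1 + \<theta> * ((norm y)\<^sup>2 / (s \<bullet> y))) * ((norm s)\<^sup>2 / (s \<bullet> y))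
       + 1 / 2 * sqrt (bfgs_disc s y \<theta>)"

definition theta_star :: "real ^ 'n \<Rightarrow> real ^ 'n \<Rightarrow> real" where
  "theta_star s y = (s \<bullet> y) / (norm y)\<^sup>2"

(* "The" minimizer over the positive reals: attained at x, and nowhere else. *)
definition is_the_minimizer_pos :: "(real \<Rightarrow> real) \<Rightarrow> real \<Rightarrow> bool" where
  "is_the_minimizer_pos f x \<longleftrightarrow> {\<theta>. is_arg_min f (\<lambda>t. 0 < t) \<theta>} = {x}"

(* The square root is taken of a nonnegative number and the two values are positive,
   so the totalised sqrt and division never leave their intended domain. *)
lemma
  fixes s y :: "real ^ 'n"
  assumes sy: "0 < s \<bullet> y" and th: "0 < \<theta>"
  shows bfgs_disc_nonneg: "0 \<le> bfgs_disc s y \<theta>"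
    and lambda_minus_pos: "0 < lambda_minus s y \<theta>"
    and lambda_plus_pos: "0 < lambda_plus s y \<theta>"
proof -
  define p where "p = (norm s)\<^sup>2 / (s \<bullet> y)"
  define q where "q = (norm y)\<^sup>2 / (s \<bullet> y)"
  define a where "a = (1 + \<theta> * q) * p"
  have "s \<noteq> 0" "y \<noteq> 0" using sy by auto
  then have p0: "0 < p" and q0: "0 < q" using sy by (simp_all add: p_def q_def)
  have a0: "0 < a" using p0 q0 th by (simp add: a_def add_pos_pos)
  have "s \<bullet> y \<le> norm s * norm y" by (rule norm_cauchy_schwarz)
  then have "(s \<bullet> y)\<^sup>2 \<le> (norm s * norm y)\<^sup>2" using sy by (intro power_mono) auto
  then have pq: "1 \<le> p * q"
    using sy by (simp add: p_def q_def field_simps power2_eq_square)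
  have p4: "norm s ^ 4 / (s \<bullet> y)\<^sup>2 = p\<^sup>2"
    by (simp add: p_def power_divide flip: power_mult)
  have d: "bfgs_disc s y \<theta> = a\<^sup>2 - 4 * \<theta> * p"
    unfolding bfgs_disc_def p4 by (simp add: a_def power_mult_distrib flip: p_def q_def)
  have "a\<^sup>2 - 4 * \<theta> * p = ((1 - \<theta> * q) * p)\<^sup>2 + 4 * (\<theta> * p) * (p * q - 1)"
    by (simp add: a_def power2_eq_square algebra_simps)
  moreover have "0 \<le> 4 * (\<theta> * p) * (p * q - 1)" using p0 th pq by simp
  ultimately show nn: "0 \<le> bfgs_disc s y \<theta>" using d by simp
  have "0 < 4 * \<theta> * p" using p0 th by simp
  then have "sqrt (bfgs_disc s y \<theta>) < sqrt (a\<^sup>2)"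
    unfolding d by (intro real_sqrt_less_mono) linarith
  then have r: "sqrt (bfgs_disc s y \<theta>) < a" using a0 by simp
  have lm: "lambda_minus s y \<theta> = (a - sqrt (bfgs_disc s y \<theta>)) / 2"
    and lp: "lambda_plus s y \<theta> = (a + sqrt (bfgs_disc s y \<theta>)) / 2"
    unfolding lambda_minus_def lambda_plus_def p_def[symmetric] q_def[symmetric]
    by (simp_all add: a_def algebra_simps diff_divide_distrib add_divide_distrib)
  show "0 < lambda_minus s y \<theta>" unfolding lm using r by simp
  show "0 < lambda_plus s y \<theta>"
    unfolding lp using add_pos_nonneg[OF a0 real_sqrt_ge_zero[OF nn]] by simp
qed

end

theory Submission
  imports Defs
begin

text \<open>
  The quotient \<open>R = AM / HM\<close> equals \<open>(a + b)\<^sup>2 / (4 a b)\<close> and is at least 1, and each of the six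
  quotients of means is a strictly increasing function of \<open>R\<close> on \<open>[1, \<infinity>)\<close>, e.g.
  \<open>QM / HM = sqrt (R (2 R - 1))\<close>. So it suffices to minimize \<open>R\<close>. For the two eigenvalues, sum and
  product are \<open>(1 + \<theta> q) p\<close> and \<open>\<theta> p\<close> with \<open>p = \<parallel>s\<parallel>\<^sup>2 / s\<^sup>Ty\<close> and \<open>q = \<parallel>y\<parallel>\<^sup>2 / s\<^sup>Ty\<close>, hence
  \<open>R = p (1 + \<theta> q)\<^sup>2 / (4 \<theta>) = p q + p (1 - \<theta> q)\<^sup>2 / (4 \<theta>)\<close>, smallest exactly at \<open>\<theta> = 1 / q\<close>.
\<close>

lemma AM_div_HM:
  assumes "0 < a" "0 < b"
  shows "AM a b / HM a b = (a + b)\<^sup>2 / (4 * (a * b))"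
  using assms by (simp add: AM_def HM_def field_simps power2_eq_square)

text \<open>The gap between \<open>(a + b)\<^sup>2\<close> and \<open>4 * (a * b)\<close> is a
  square. The bound places the quotient in \<open>{1..}\<close>, where all the functions of it used
  below are monotone.\<close>

lemma one_le_AM_div_HM:
  assumes "0 < a" "0 < b"
  shows "1 \<le> AM a b / HM a b"
proof -
  have "(a + b)\<^sup>2 = 4 * (a * b) + (a - b)\<^sup>2"
    by (simp add: power2_eq_square algebra_simps)
  then show ?thesis
    using assms by (simp add: AM_div_HM)
qed

lemma AM_div_GM:
  assumes "0 < a" "0 < b"
  shows "AM a b / GM a b = sqrt (AM a b / HM a b)"
proof -
  have "AM a b / GM a b = sqrt ((AM a b)\<^sup>2 / (a * b))"
    using assms by (simp add: GM_def AM_def real_sqrt_divide)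
  also have "(AM a b)\<^sup>2 / (a * b) = AM a b / HM a b"
    unfolding AM_div_HM[OF assms] by (simp add: AM_def power_divide)
  finally show ?thesis .
qed

text \<open>\<open>GM\<close> is also the geometric mean of \<open>AM\<close> and \<open>HM\<close>,
  so this quotient coincides with \<open>AM a b / GM a b\<close>.\<close>

lemma GM_div_HM:
  assumes "0 < a" "0 < b"
  shows "GM a b / HM a b = sqrt (AM a b / HM a b)"
proof -
  have "0 < GM a b" "(GM a b)\<^sup>2 = a * b"
    using assms by (simp_all add: GM_def)
  moreover have "a * b = AM a b * HM a b"
    using assms by (simp add: AM_def HM_def field_simps)
  moreover have "0 < HM a b"
    using assms by (simp add: HM_def add_pos_pos)
  ultimately have "GM a b / HM a b = AM a b / GM a b"
    by (simp add: field_simps power2_eq_square)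
  then show ?thesis
    using assms by (simp add: AM_div_GM)
qed

text \<open>Under the root this is the identity QM^2 = 2 AM^2 - GM^2 divided by GM^2, where AM^2 /
  GM^2 = AM / HM.\<close>

lemma QM_div_GM:
  assumes "0 < a" "0 < b"
  shows "QM a b / GM a b = sqrt (2 * (AM a b / HM a b) - 1)"
proof -
  have "QM a b / GM a b = sqrt (((a\<^sup>2 + b\<^sup>2) / 2) / (a * b))"
    by (simp only: QM_def GM_def real_sqrt_divide)
  also have "((a\<^sup>2 + b\<^sup>2) / 2) / (a * b) = 2 * (AM a b / HM a b) - 1"
    using assms by (simp add: AM_div_HM field_simps power2_eq_square)
  finally show ?thesis .
qed

lemma QM_div_AM:
  assumes "0 < a" "0 < b"
  shows "QM a b / AM a b = sqrt (2 - 1 / (AM a b / HM a b))"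
proof -
  let ?R = "AM a b / HM a b"
  have R: "0 < ?R"
    using one_le_AM_div_HM[OF assms] by linarith
  have "0 < GM a b"
    using assms by (simp add: GM_def)
  then have "QM a b / AM a b = (QM a b / GM a b) / (AM a b / GM a b)"
    by simp
  also have "\<dots> = sqrt ((2 * ?R - 1) / ?R)"
    by (simp only: QM_div_GM[OF assms] AM_div_GM[OF assms] real_sqrt_divide)
  \<comment> \<open>With \<open>?R\<close> occurring only once, monotonicity can be read
    off.\<close>
  also have "(2 * ?R - 1) / ?R = 2 - 1 / ?R"
    using R by (subst diff_divide_distrib) auto
  finally show ?thesis .
qed

lemma QM_div_HM:
  assumes "0 < a" "0 < b"
  shows "QM a b / HM a b = sqrt ((2 * (AM a b / HM a b) - 1) * (AM a b / HM a b))"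
proof -
  have "0 < GM a b"
    using assms by (simp add: GM_def)
  then have "QM a b / HM a b = (QM a b / GM a b) * (GM a b / HM a b)"
    by simp
  then show ?thesis
    by (simp only: QM_div_GM[OF assms] GM_div_HM[OF assms] real_sqrt_mult)
qed

lemma lambda_sum:
  "lambda_minus s y \<theta> + lambda_plus s y \<theta> =
     (1 + \<theta> * ((norm y)\<^sup>2 / (s \<bullet> y))) * ((norm s)\<^sup>2 / (s \<bullet> y))"
  by (simp add: lambda_minus_def lambda_plus_def)

text \<open>The two values are conjugate, so their product is a difference of squares in which
  \<open>a\<^sup>2\<close> cancels and only the term subtracted in the radicand survives.\<close>

lemma lambda_prod:
  assumes "0 < s \<bullet> y" "0 < \<theta>"
  shows "lambda_minus s y \<theta> * lambda_plus s y \<theta> = \<theta> * ((norm s)\<^sup>2 / (s \<bullet> y))"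
proof -
  define a where "a = (1 + \<theta> * ((norm y)\<^sup>2 / (s \<bullet> y))) * ((norm s)\<^sup>2 / (s \<bullet> y))"
  have "(norm s ^ 4 / (s \<bullet> y)\<^sup>2) = ((norm s)\<^sup>2 / (s \<bullet> y))\<^sup>2"
    by (simp add: power_divide flip: power_mult)
  then have d: "bfgs_disc s y \<theta> = a\<^sup>2 - 4 * (\<theta> * ((norm s)\<^sup>2 / (s \<bullet> y)))"
    by (simp only: bfgs_disc_def a_def power_mult_distrib mult.assoc)
  have "lambda_minus s y \<theta> * lambda_plus s y \<theta> =
      (a / 2 - sqrt (bfgs_disc s y \<theta>) / 2) * (a / 2 + sqrt (bfgs_disc s y \<theta>) / 2)"
    by (simp add: lambda_minus_def lambda_plus_def a_def mult.commute)
  also have "\<dots> = (a\<^sup>2 - (sqrt (bfgs_disc s y \<theta>))\<^sup>2) / 4"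
    by (simp add: power2_eq_square algebra_simps)
  \<comment> \<open>Squaring undoes \<open>sqrt\<close> only for a nonnegative radicand.\<close>
  also have "\<dots> = (a\<^sup>2 - bfgs_disc s y \<theta>) / 4"
    using bfgs_disc_nonneg[OF assms] by simp
  finally show ?thesis
    by (simp add: d)
qed

lemma AM_div_HM_lambda:
  assumes "0 < s \<bullet> y" "0 < \<theta>"
  defines "p \<equiv> (norm s)\<^sup>2 / (s \<bullet> y)" and "q \<equiv> (norm y)\<^sup>2 / (s \<bullet> y)"
  shows "AM (lambda_minus s y \<theta>) (lambda_plus s y \<theta>) / HM (lambda_minus s y \<theta>) (lambda_plus s y \<theta>)
    = p * q + p * (1 - \<theta> * q)\<^sup>2 / (4 * \<theta>)"
proof -
  have "s \<noteq> 0"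
    using assms(1) by auto
  then have "0 < p"
    using assms(1) by (simp add: p_def)
  have "AM (lambda_minus s y \<theta>) (lambda_plus s y \<theta>) / HM (lambda_minus s y \<theta>) (lambda_plus s y \<theta>)
    = ((1 + \<theta> * q) * p)\<^sup>2 / (4 * (\<theta> * p))"
    unfolding AM_div_HM[OF lambda_minus_pos[OF assms(1,2)] lambda_plus_pos[OF assms(1,2)]]
      lambda_sum lambda_prod[OF assms(1,2)] p_def q_def ..
  \<comment> \<open>Uses (1 + u)^2 = 4 u + (1 - u)^2 with u = \<open>\<theta> * q\<close>; the part
    4 u yields the summand \<open>p * q\<close>, free of \<open>\<theta>\<close>.\<close>
  also have "\<dots> = p * q + p * (1 - \<theta> * q)\<^sup>2 / (4 * \<theta>)"
    using \<open>0 < p\<close> \<open>0 < \<theta>\<close> by (simp add: field_simps power2_eq_square)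
  finally show ?thesis .
qed

text \<open>Strictness against every other positive point gives attainment and uniqueness at
  once.\<close>

lemma is_the_minimizer_posI:
  assumes "0 < x" and "\<And>t. 0 < t \<Longrightarrow> t \<noteq> x \<Longrightarrow> f x < f t"
  shows "is_the_minimizer_pos f x"
proof -
  have "is_arg_min f (\<lambda>t. 0 < t) \<theta> \<longleftrightarrow> \<theta> = x" for \<theta>
    unfolding is_arg_min_def using assms by (metis less_asym)
  then show ?thesis
    by (simp add: is_the_minimizer_pos_def)
qed

text \<open>Treats the six quotients uniformly: each is an \<open>h\<close> that factors through AM
  / HM by some \<open>g\<close>. Strict monotonicity of \<open>g\<close> carries the strict minimum
  over, and with it uniqueness.\<close>

lemma theta_star_minimizer:
  fixes s y :: "real ^ 'n"
  assumes sy: "0 < s \<bullet> y"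
    and g: "strict_mono_on {1..} g"
    and h: "\<And>a b. 0 < a \<Longrightarrow> 0 < b \<Longrightarrow> h a b = g (AM a b / HM a b)"
  shows "is_the_minimizer_pos (\<lambda>\<theta>. h (lambda_minus s y \<theta>) (lambda_plus s y \<theta>)) (theta_star s y)"
proof (rule is_the_minimizer_posI)
  define R where "R \<theta> =
    AM (lambda_minus s y \<theta>) (lambda_plus s y \<theta>) / HM (lambda_minus s y \<theta>) (lambda_plus s y \<theta>)" for \<theta>
  define p where "p = (norm s)\<^sup>2 / (s \<bullet> y)"
  define q where "q = (norm y)\<^sup>2 / (s \<bullet> y)"
  have "s \<noteq> 0" "y \<noteq> 0"
    using sy by auto
  then have p: "0 < p" and q: "0 < q"
    using sy by (simp_all add: p_def q_def)
  have star: "theta_star s y = 1 / q"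
    by (simp add: theta_star_def q_def)
  show pos: "0 < theta_star s y"
    using q by (simp add: star)
  fix t :: real
  assume t: "0 < t" "t \<noteq> theta_star s y"
  have R: "R \<theta> = p * q + p * (1 - \<theta> * q)\<^sup>2 / (4 * \<theta>)" "1 \<le> R \<theta>"
    "h (lambda_minus s y \<theta>) (lambda_plus s y \<theta>) = g (R \<theta>)" if "0 < \<theta>" for \<theta>
    unfolding R_def p_def q_def
    by (intro AM_div_HM_lambda one_le_AM_div_HM h lambda_minus_pos lambda_plus_pos sy that)+
  \<comment> \<open>The second summand of \<open>R\<close> vanishes at 1 / \<open>q\<close> and is
    positive at every other \<open>t\<close> > 0.\<close>
  have "t * q \<noteq> 1"
    using t(2) q by (auto simp: star field_simps)
  then have "0 < p * (1 - t * q)\<^sup>2 / (4 * t)"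
    using p t(1) by simp
  then have "R (theta_star s y) < R t"
    using R(1)[OF pos] R(1)[OF t(1)] q by (simp add: star)
  then have "g (R (theta_star s y)) < g (R t)"
    using R(2)[OF pos] R(2)[OF t(1)] by (intro strict_mono_onD[OF g]) auto
  then show "h (lambda_minus s y (theta_star s y)) (lambda_plus s y (theta_star s y))
      < h (lambda_minus s y t) (lambda_plus s y t)"
    by (simp only: R(3)[OF pos] R(3)[OF t(1)])
qed

theorem mainTheorem3:
  fixes s y :: "real ^ 'n"
  assumes "2 \<le> CARD('n)"
    and "0 < s \<bullet> y"
  shows "is_the_minimizer_pos
      (\<lambda>\<theta>. AM (lambda_minus s y \<theta>) (lambda_plus s y \<theta>) / GM (lambda_minus s y \<theta>) (lambda_plus s y \<theta>))
      (theta_star s y) \<and>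
    is_the_minimizer_pos
      (\<lambda>\<theta>. GM (lambda_minus s y \<theta>) (lambda_plus s y \<theta>) / HM (lambda_minus s y \<theta>) (lambda_plus s y \<theta>))
      (theta_star s y) \<and>
    is_the_minimizer_pos
      (\<lambda>\<theta>. AM (lambda_minus s y \<theta>) (lambda_plus s y \<theta>) / HM (lambda_minus s y \<theta>) (lambda_plus s y \<theta>))
      (theta_star s y) \<and>
    is_the_minimizer_pos
      (\<lambda>\<theta>. QM (lambda_minus s y \<theta>) (lambda_plus s y \<theta>) / AM (lambda_minus s y \<theta>) (lambda_plus s y \<theta>))
      (theta_star s y) \<and>
    is_the_minimizer_pos
      (\<lambda>\<theta>. QM (lambda_minus s y \<theta>) (lambda_plus s y \<theta>) / GM (lambda_minus s y \<theta>) (lambda_plus s y \<theta>))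
      (theta_star s y) \<and>
    is_the_minimizer_pos
      (\<lambda>\<theta>. QM (lambda_minus s y \<theta>) (lambda_plus s y \<theta>) / HM (lambda_minus s y \<theta>) (lambda_plus s y \<theta>))
      (theta_star s y)"
proof (intro conjI)
  note min = theta_star_minimizer[OF assms(2)]
  have sqrt_mono: "strict_mono_on {1..} (\<lambda>r::real. sqrt r)"
    by (simp add: strict_mono_on_def)
  have id_mono: "strict_mono_on {1..} (\<lambda>r::real. r)"
    by (simp add: strict_mono_on_def)
  show "is_the_minimizer_pos
      (\<lambda>\<theta>. AM (lambda_minus s y \<theta>) (lambda_plus s y \<theta>) / GM (lambda_minus s y \<theta>) (lambda_plus s y \<theta>))
      (theta_star s y)"
    by (rule min[OF sqrt_mono AM_div_GM])
  show "is_the_minimizer_pos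
      (\<lambda>\<theta>. GM (lambda_minus s y \<theta>) (lambda_plus s y \<theta>) / HM (lambda_minus s y \<theta>) (lambda_plus s y \<theta>))
      (theta_star s y)"
    by (rule min[OF sqrt_mono GM_div_HM])
  show "is_the_minimizer_pos
      (\<lambda>\<theta>. AM (lambda_minus s y \<theta>) (lambda_plus s y \<theta>) / HM (lambda_minus s y \<theta>) (lambda_plus s y \<theta>))
      (theta_star s y)"
    \<comment> \<open>Here \<open>g\<close> is the identity, so the factorization is
      reflexivity.\<close>
    by (rule min[OF id_mono refl])
  have QM_AM_mono: "strict_mono_on {1..} (\<lambda>r::real. sqrt (2 - 1 / r))"
    by (auto simp: strict_mono_on_def intro!: divide_strict_left_mono)
  show "is_the_minimizer_pos
      (\<lambda>\<theta>. QM (lambda_minus s y \<theta>) (lambda_plus s y \<theta>) / AM (lambda_minus s y \<theta>) (lambda_plus s y \<theta>))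
      (theta_star s y)"
    by (rule min[OF QM_AM_mono QM_div_AM])
  have QM_GM_mono: "strict_mono_on {1..} (\<lambda>r::real. sqrt (2 * r - 1))"
    by (simp add: strict_mono_on_def)
  show "is_the_minimizer_pos
      (\<lambda>\<theta>. QM (lambda_minus s y \<theta>) (lambda_plus s y \<theta>) / GM (lambda_minus s y \<theta>) (lambda_plus s y \<theta>))
      (theta_star s y)"
    by (rule min[OF QM_GM_mono QM_div_GM])
  \<comment> \<open>Both factors are increasing and positive for r \<ge> 1, so their product
    increases.\<close>
  have QM_HM_mono: "strict_mono_on {1..} (\<lambda>r::real. sqrt ((2 * r - 1) * r))"
    by (intro strict_mono_onI real_sqrt_less_mono mult_strict_mono) auto
  show "is_the_minimizer_pos
      (\<lambda>\<theta>. QM (lambda_minus s y \<theta>) (lambda_plus s y \<theta>) / HM (lambda_minus s y \<theta>) (lambda_plus s y \<theta>))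
      (theta_star s y)"
    by (rule min[OF QM_HM_mono QM_div_HM])
qed

end
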